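(* Let $(X,\tau,\mathcal{I})$ be an ideal topological space, $(Y,\sigma)$ a topological space, and $f:(X,\tau,\mathcal{I})\to(Y,\sigma)$ a function. Then $f$ is continuous (with respect to $\tau$ and $\sigma$) if and only if $f$ is $*$-continuous and $\sharp$-continuous.
   Context: An ideal on a set $X$ is a non-empty family $\mathcal{I}\subseteq 2^X$ ($2^X$ is the power set of $X$) closed under taking subsets and finite unions. An ideal topological space $(X,\tau,\mathcal{I})$ is a topological space $(X,\tau)$ together with an ideal $\mathcal{I}$ on $X$. $\tau(x)$ denotes the collection of all open sets containing $x$, and $S^c=X\setminus S$. The local function of $A\subseteq X$ is $A^*=\{x\in X\mid(\forall U\in\tau(x))(U\cap A\notin\mathcal{I})\}$; put $cl^*(A)=A\cup A^*$ and let $\tau^*=\{A\subseteq X\mid cl^*(X\setminus A)=X\setminus A\}$ (the $*$-topology). The sharp function of $A\subseteq X$ is $A^\sharp=\{x\in X\mid(\forall U\in\tau(x))(\exists I\in\mathcal{I}\setminus\{\emptyset\})(I\cap(U\cap A)^c=\emptyset)\}$; put $cl^\sharp(A)=A\cup A^\sharp$ and let $\tau^\sharp=\{A\subseteq X\mid cl^\sharp(X\setminus A)=X\setminus A\}$ (the $\sharp$-topology). The function $f$ is $*$-continuous (resp. $\sharp$-continuous) if $f^{-1}[V]\in\tau^*$ (resp. $f^{-1}[V]\in\tau^\sharp$) for each open set $V$ of $Y$. *)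

theory Defs
  imports "HOL-Analysis.Abstract_Topology"
begin

definition ideal_on :: "'a set \<Rightarrow> 'a set set \<Rightarrow> bool" where
  "ideal_on X I \<longleftrightarrow>
     I \<subseteq> Pow X \<and> I \<noteq> {} \<and>
     (\<forall>A B. A \<in> I \<and> B \<subseteq> A \<longrightarrow> B \<in> I) \<and>
     (\<forall>A\<in>I. \<forall>B\<in>I. A \<union> B \<in> I)"

definition local_function :: "'a topology \<Rightarrow> 'a set set \<Rightarrow> 'a set \<Rightarrow> 'a set" where
  "local_function T I A =
     {x \<in> topspace T. \<forall>U. openin T U \<and> x \<in> U \<longrightarrow> U \<inter> A \<notin> I}"

definition cl_star :: "'a topology \<Rightarrow> 'a set set \<Rightarrow> 'a set \<Rightarrow> 'a set" where
  "cl_star T I A = A \<union> local_function T I A"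

definition star_topology :: "'a topology \<Rightarrow> 'a set set \<Rightarrow> 'a set set" where
  "star_topology T I =
     {A. A \<subseteq> topspace T \<and> cl_star T I (topspace T - A) = topspace T - A}"

definition sharp_function :: "'a topology \<Rightarrow> 'a set set \<Rightarrow> 'a set \<Rightarrow> 'a set" where
  "sharp_function T I A =
     {x \<in> topspace T. \<forall>U. openin T U \<and> x \<in> U \<longrightarrow>
        (\<exists>J \<in> I - {{}}. J \<inter> (topspace T - (U \<inter> A)) = {})}"

definition cl_sharp :: "'a topology \<Rightarrow> 'a set set \<Rightarrow> 'a set \<Rightarrow> 'a set" where
  "cl_sharp T I A = A \<union> sharp_function T I A"

definition sharp_topology :: "'a topology \<Rightarrow> 'a set set \<Rightarrow> 'a set set" where
  "sharp_topology T I =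
     {A. A \<subseteq> topspace T \<and> cl_sharp T I (topspace T - A) = topspace T - A}"

(* HOL functions are total on the type, so preimages are cut down to the space. *)
definition star_continuous ::
    "'a topology \<Rightarrow> 'a set set \<Rightarrow> 'b topology \<Rightarrow> ('a \<Rightarrow> 'b) \<Rightarrow> bool" where
  "star_continuous T I S f \<longleftrightarrow>
     (\<forall>V. openin S V \<longrightarrow> f -` V \<inter> topspace T \<in> star_topology T I)"

definition sharp_continuous ::
    "'a topology \<Rightarrow> 'a set set \<Rightarrow> 'b topology \<Rightarrow> ('a \<Rightarrow> 'b) \<Rightarrow> bool" where
  "sharp_continuous T I S f \<longleftrightarrow>
     (\<forall>V. openin S V \<longrightarrow> f -` V \<inter> topspace T \<in> sharp_topology T I)"

end

theory Submission
  imports Defs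
begin

text \<open>Everything rests on the identity \<open>T closure_of A = A\<^sup>* \<union> A\<^sup>\<sharp>\<close>, which splits the usual closure
  according to the way in which \<open>A\<close> accumulates at a point: either every trace \<open>U \<inter> A\<close> on a
  neighbourhood \<open>U\<close> is too large to be in the ideal, or every trace contains a non-empty member of
  the ideal. Once this is known (\<open>closure_of_eq_local_Un_sharp\<close>), a set is closed exactly when it
  contains both of its parts \<open>A\<^sup>*\<close> and \<open>A\<^sup>\<sharp>\<close>, that is, the open sets of \<open>T\<close> are the sets that are
  both \<open>*\<close>-open and \<open>\<sharp>\<close>-open (\<open>openin_iff_star_sharp\<close>). Continuity is a condition on preimages
  of open sets, so the theorem follows by applying this to each preimage.\<close>

text \<open>For \<open>\<subseteq>\<close>: if \<open>x\<close> belonged to neither part, there would be a neighbourhood \<open>U\<close> with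
  \<open>U \<inter> A \<in> I\<close> and a neighbourhood \<open>V\<close> for which \<open>V \<inter> A\<close> contains no non-empty member of \<open>I\<close>.
  But \<open>U \<inter> V \<inter> A\<close> is non-empty when \<open>x\<close> is in the closure, and it is such a member. For \<open>\<supseteq>\<close>:
  in both cases the traces are non-empty, in the first because \<open>{} \<in> I\<close>.\<close>

lemma closure_of_eq_local_Un_sharp:
  assumes "ideal_on (topspace T) I"
  shows "T closure_of A = local_function T I A \<union> sharp_function T I A"
proof (intro equalityI subsetI)
  have down: "C \<in> I" if "B \<in> I" "C \<subseteq> B" for B C
    using assms that unfolding ideal_on_def by metis
  fix x assume x: "x \<in> T closure_of A"
  show "x \<in> local_function T I A \<union> sharp_function T I A"
  proof (rule ccontr)
    assume "\<not> ?thesis"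
    then have not_local: "x \<notin> local_function T I A" and not_sharp: "x \<notin> sharp_function T I A"
      by simp_all
    have space: "x \<in> topspace T"
      and meets: "\<And>W. x \<in> W \<Longrightarrow> openin T W \<Longrightarrow> \<exists>y. y \<in> A \<and> y \<in> W"
      using x by (simp_all add: in_closure_of)
    from not_local space obtain U where U: "openin T U" "x \<in> U" "U \<inter> A \<in> I"
      unfolding local_function_def by auto
    from not_sharp space obtain V where V: "openin T V" "x \<in> V"
        and none: "\<forall>J \<in> I - {{}}. J \<inter> (topspace T - (V \<inter> A)) \<noteq> {}"
      unfolding sharp_function_def by auto
    let ?J = "(U \<inter> V) \<inter> A"
    have "?J \<in> I"
      by (rule down[OF U(3)]) blast
    moreover have "?J \<noteq> {}"
      using meets[of "U \<inter> V"] U V openin_Int[OF U(1) V(1)] by auto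
    ultimately have "?J \<inter> (topspace T - (V \<inter> A)) \<noteq> {}"
      using none by simp
    then show False by auto
  qed
next
  obtain B where "B \<in> I"
    using assms by (auto simp: ideal_on_def)
  then have empty: "{} \<in> I"
    using assms empty_subsetI[of B] unfolding ideal_on_def by metis
  have sub: "J \<subseteq> topspace T" if "J \<in> I" for J
    using assms that by (auto simp: ideal_on_def)
  fix x assume x: "x \<in> local_function T I A \<union> sharp_function T I A"
  have "\<exists>y. y \<in> A \<and> y \<in> U" if U: "openin T U" "x \<in> U" for U
  proof -
    have "U \<inter> A \<notin> I \<or> (\<exists>J\<in>I - {{}}. J \<inter> (topspace T - (U \<inter> A)) = {})"
      using x U by (auto simp: local_function_def sharp_function_def)
    then have "U \<inter> A \<noteq> {}"
    proof
      assume "U \<inter> A \<notin> I"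
      with empty show ?thesis by auto
    next
      assume "\<exists>J\<in>I - {{}}. J \<inter> (topspace T - (U \<inter> A)) = {}"
      then obtain J where "J \<in> I" "J \<noteq> {}" "J \<inter> (topspace T - (U \<inter> A)) = {}" by auto
      with sub[of J] show ?thesis by auto
    qed
    then show ?thesis by blast
  qed
  moreover have "x \<in> topspace T"
    using x by (auto simp: local_function_def sharp_function_def)
  ultimately show "x \<in> T closure_of A"
    unfolding in_closure_of by blast
qed

lemma openin_iff_star_sharp:
  assumes "ideal_on (topspace T) I"
  shows "openin T A \<longleftrightarrow> A \<in> star_topology T I \<and> A \<in> sharp_topology T I"
proof -
  have "openin T A \<longleftrightarrow>
      A \<subseteq> topspace T \<and> T closure_of (topspace T - A) \<subseteq> topspace T - A"
    using closure_of_subset_eq[of "topspace T - A" T] by (auto simp: openin_closedin_eq)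
  then show ?thesis
    unfolding closure_of_eq_local_Un_sharp[OF assms] star_topology_def sharp_topology_def
      cl_star_def cl_sharp_def by blast
qed

theorem theorem7p8:
  fixes T :: "'a topology" and I :: "'a set set" and S :: "'b topology" and f :: "'a \<Rightarrow> 'b"
  assumes "ideal_on (topspace T) I"
    and "f \<in> topspace T \<rightarrow> topspace S"
  shows "continuous_map T S f \<longleftrightarrow> star_continuous T I S f \<and> sharp_continuous T I S f"
proof -
  have "f -` V \<inter> topspace T = {x \<in> topspace T. f x \<in> V}" for V
    by blast
  then have "continuous_map T S f \<longleftrightarrow> (\<forall>V. openin S V \<longrightarrow> openin T (f -` V \<inter> topspace T))"
    using assms(2) by (simp add: continuous_map_def)
  then show ?thesis
    unfolding openin_iff_star_sharp[OF assms(1)] star_continuous_def sharp_continuous_def by blast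
qed

end
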